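(* Let $R$ be a commutative ring with $1\neq0$ and let $S\subseteq\operatorname{Reg}(R)$ be a nonempty multiplicative subset. The following are equivalent. (1) Localization at $S$ commutes with arbitrary intersections of ideals; that is, $\bigl(\bigcap_{\lambda\in\Lambda}I_\lambda\bigr)_S=\bigcap_{\lambda\in\Lambda}(I_\lambda)_S$ inside $R_S$ for every family $(I_\lambda)_{\lambda\in\Lambda}$ of ideals of $R$. (2) $S$ is strongly multiplicative. (3) Every element of $S$ is a unit. (4) $N_R(S)=\operatorname{Reg}(R)$. In particular, every nontrivial strongly multiplicative localization must invert a zero divisor: if $T$ is any strongly multiplicative set of $R$ for which the localization map $R\to R_T$ is not an isomorphism, then $T$ contains a zero divisor.
   Context: $\operatorname{Reg}(R)=\{r\in R: rx=0\Rightarrow x=0\}$ is the set of non-zerodivisors of $R$. For nonempty $S\subseteq\operatorname{Reg}(R)$, $N_R(S)=\{x\in\operatorname{Reg}(R): xR\cap sR=xsR\text{ for all }s\in S\}$. A multiplicative set $S$ of $R$ is a subset with $0\notin S$, $1\in S$, closed under products; it is strongly multiplicative if $\bigl(\bigcap_{i\in\Delta}s_iR\bigr)\cap S\neq\varnothing$ for every family $(s_i)_{i\in\Delta}$ of elements of $S$. *)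

theory Defs
  imports "HOL-Algebra.QuotRing"
begin

definition Reg :: "('a, 'm) ring_scheme \<Rightarrow> 'a set" where
  "Reg R = {r \<in> carrier R. \<forall>x\<in>carrier R. r \<otimes>\<^bsub>R\<^esub> x = \<zero>\<^bsub>R\<^esub> \<longrightarrow> x = \<zero>\<^bsub>R\<^esub>}"

definition N_set :: "('a, 'm) ring_scheme \<Rightarrow> 'a set \<Rightarrow> 'a set" where
  "N_set R S = {x \<in> Reg R. \<forall>s\<in>S. PIdl\<^bsub>R\<^esub> x \<inter> PIdl\<^bsub>R\<^esub> s = PIdl\<^bsub>R\<^esub> (x \<otimes>\<^bsub>R\<^esub> s)}"

definition multiplicative_set :: "('a, 'm) ring_scheme \<Rightarrow> 'a set \<Rightarrow> bool" where
  "multiplicative_set R S \<longleftrightarrow> submonoid S R \<and> \<zero>\<^bsub>R\<^esub> \<notin> S"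

text \<open>
  Families are indexed by sets of elements of the ring.  This loses no generality, since the
  intersection depends only on the range of the family; see \<open>strongly_multiplicative_family\<close>
  below for arbitrary index types.  Intersecting with the carrier makes the intersection of the
  empty family the whole ring.
\<close>

definition strongly_multiplicative :: "('a, 'm) ring_scheme \<Rightarrow> 'a set \<Rightarrow> bool" where
  "strongly_multiplicative R S \<longleftrightarrow> multiplicative_set R S \<and>
     (\<forall>(\<Delta> :: 'a set) s. (\<forall>i\<in>\<Delta>. s i \<in> S) \<longrightarrow>
        (carrier R \<inter> (\<Inter>i\<in>\<Delta>. PIdl\<^bsub>R\<^esub> (s i))) \<inter> S \<noteq> {})"

text \<open>
  The localization is formed for an arbitrary multiplicative set, possibly containing zero
  divisors; hence the extra factor \<open>u\<close> in the relation.
\<close>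

definition loc_rel :: "('a, 'm) ring_scheme \<Rightarrow> 'a set \<Rightarrow> (('a \<times> 'a) \<times> ('a \<times> 'a)) set" where
  "loc_rel R S = {((a, s), (b, t)). a \<in> carrier R \<and> b \<in> carrier R \<and> s \<in> S \<and> t \<in> S \<and>
     (\<exists>u\<in>S. u \<otimes>\<^bsub>R\<^esub> (a \<otimes>\<^bsub>R\<^esub> t \<ominus>\<^bsub>R\<^esub> b \<otimes>\<^bsub>R\<^esub> s) = \<zero>\<^bsub>R\<^esub>)}"

definition loc_frac :: "('a, 'm) ring_scheme \<Rightarrow> 'a set \<Rightarrow> 'a \<Rightarrow> 'a \<Rightarrow> ('a \<times> 'a) set" where
  "loc_frac R S a s = loc_rel R S `` {(a, s)}"

definition localization :: "('a, 'm) ring_scheme \<Rightarrow> 'a set \<Rightarrow> ('a \<times> 'a) set ring" where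
  "localization R S =
    \<lparr>carrier = (carrier R \<times> S) // loc_rel R S,
     monoid.mult = (\<lambda>A B. \<Union>(a, s)\<in>A. \<Union>(b, t)\<in>B. loc_frac R S (a \<otimes>\<^bsub>R\<^esub> b) (s \<otimes>\<^bsub>R\<^esub> t)),
     one = loc_frac R S \<one>\<^bsub>R\<^esub> \<one>\<^bsub>R\<^esub>,
     ring.zero = loc_frac R S \<zero>\<^bsub>R\<^esub> \<one>\<^bsub>R\<^esub>,
     add = (\<lambda>A B. \<Union>(a, s)\<in>A. \<Union>(b, t)\<in>B.
              loc_frac R S (a \<otimes>\<^bsub>R\<^esub> t \<oplus>\<^bsub>R\<^esub> b \<otimes>\<^bsub>R\<^esub> s) (s \<otimes>\<^bsub>R\<^esub> t))\<rparr>"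

definition loc_map :: "('a, 'm) ring_scheme \<Rightarrow> 'a set \<Rightarrow> 'a \<Rightarrow> ('a \<times> 'a) set" where
  "loc_map R S a = loc_frac R S a \<one>\<^bsub>R\<^esub>"

definition loc_ideal :: "('a, 'm) ring_scheme \<Rightarrow> 'a set \<Rightarrow> 'a set \<Rightarrow> ('a \<times> 'a) set set" where
  "loc_ideal R S I = {loc_frac R S a s | a s. a \<in> I \<and> s \<in> S}"

text \<open>
  As above, the index type is immaterial as long as it is large enough to index every set of
  ideals; see \<open>loc_commutes_Inter_family\<close>.
\<close>

definition loc_commutes_Inter :: "('a, 'm) ring_scheme \<Rightarrow> 'a set \<Rightarrow> bool" where
  "loc_commutes_Inter R S \<longleftrightarrow>
     (\<forall>(\<Lambda> :: 'a set set) I. (\<forall>i\<in>\<Lambda>. ideal (I i) R) \<longrightarrow>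
        loc_ideal R S (carrier R \<inter> (\<Inter>i\<in>\<Lambda>. I i)) =
        carrier (localization R S) \<inter> (\<Inter>i\<in>\<Lambda>. loc_ideal R S (I i)))"

lemma strongly_multiplicative_family:
  fixes \<Delta> :: "'i set"
  assumes "strongly_multiplicative R S" and "\<forall>i\<in>\<Delta>. s i \<in> S"
  shows "(carrier R \<inter> (\<Inter>i\<in>\<Delta>. PIdl\<^bsub>R\<^esub> (s i))) \<inter> S \<noteq> {}"
proof -
  have "(\<forall>i\<in>s ` \<Delta>. id i \<in> S) \<longrightarrow>
      (carrier R \<inter> (\<Inter>i\<in>s ` \<Delta>. PIdl\<^bsub>R\<^esub> (id i))) \<inter> S \<noteq> {}"
    using assms(1) unfolding strongly_multiplicative_def by blast
  then show ?thesis
    using assms(2) by (simp add: image_image)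
qed

lemma loc_commutes_Inter_family:
  fixes \<Lambda> :: "'i set"
  assumes "loc_commutes_Inter R S" and "\<forall>i\<in>\<Lambda>. ideal (I i) R"
  shows "loc_ideal R S (carrier R \<inter> (\<Inter>i\<in>\<Lambda>. I i)) =
    carrier (localization R S) \<inter> (\<Inter>i\<in>\<Lambda>. loc_ideal R S (I i))"
proof -
  have "(\<forall>i\<in>I ` \<Lambda>. ideal (id i) R) \<longrightarrow>
      loc_ideal R S (carrier R \<inter> (\<Inter>i\<in>I ` \<Lambda>. id i)) =
      carrier (localization R S) \<inter> (\<Inter>i\<in>I ` \<Lambda>. loc_ideal R S (id i))"
    using assms(1)[unfolded loc_commutes_Inter_def]
    by (rule spec[where x = id, OF spec[where x = "I ` \<Lambda>"]])
  then show ?thesis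
    using assms(2) by (simp add: image_image)
qed

text \<open>The operations are well defined, and the localization is a commutative ring.\<close>

lemma (in cring) mult_minus_eq_zero_iff:
  assumes "u \<in> carrier R" "x \<in> carrier R" "y \<in> carrier R"
  shows "u \<otimes> (x \<ominus> y) = \<zero> \<longleftrightarrow> u \<otimes> x = u \<otimes> y"
proof -
  have "u \<otimes> (x \<ominus> y) = u \<otimes> x \<ominus> u \<otimes> y"
    using assms by (simp add: a_minus_def r_distr r_minus)
  moreover have "u \<otimes> x = (u \<otimes> x \<ominus> u \<otimes> y) \<oplus> u \<otimes> y"
    using assms by (simp add: a_minus_def a_assoc l_neg)
  moreover have "u \<otimes> y \<ominus> u \<otimes> y = \<zero>"
    using assms by (simp add: a_minus_def r_neg)
  ultimately show ?thesis
    using assms by (metis l_zero m_closed)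
qed

lemma loc_relE:
  assumes "(p, q) \<in> loc_rel R S"
  obtains a s b t u where "p = (a, s)" "q = (b, t)" "a \<in> carrier R" "b \<in> carrier R"
    "s \<in> S" "t \<in> S" "u \<in> S" "u \<otimes>\<^bsub>R\<^esub> (a \<otimes>\<^bsub>R\<^esub> t \<ominus>\<^bsub>R\<^esub> b \<otimes>\<^bsub>R\<^esub> s) = \<zero>\<^bsub>R\<^esub>"
  using assms by (cases p; cases q) (auto simp: loc_rel_def)

lemma (in cring) loc_rel_equiv:
  assumes "submonoid S R"
  shows "equiv (carrier R \<times> S) (loc_rel R S)"
proof -
  interpret S: submonoid S R by fact
  have S: "x \<in> carrier R" if "x \<in> S" for x using that S.subset by blast
  show ?thesis
  proof (rule equivI)
    show "loc_rel R S \<subseteq> (carrier R \<times> S) \<times> (carrier R \<times> S)"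
      unfolding loc_rel_def by auto
    show "refl_on (carrier R \<times> S) (loc_rel R S)"
    proof (rule refl_onI)
      fix p assume "p \<in> carrier R \<times> S"
      then obtain a s where "p = (a, s)" "a \<in> carrier R" "s \<in> S" by blast
      moreover from this have "\<one> \<otimes> (a \<otimes> s \<ominus> a \<otimes> s) = \<zero>"
        by (simp add: S a_minus_def r_neg)
      ultimately show "(p, p) \<in> loc_rel R S"
        by (auto simp: loc_rel_def intro: bexI[of _ \<one>])
    qed
    show "sym (loc_rel R S)"
    proof (rule symI)
      fix p q assume "(p, q) \<in> loc_rel R S"
      then obtain a s b t u where *: "p = (a, s)" "q = (b, t)" "a \<in> carrier R" "b \<in> carrier R"
        "s \<in> S" "t \<in> S" "u \<in> S" "u \<otimes> (a \<otimes> t \<ominus> b \<otimes> s) = \<zero>"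
        by (rule loc_relE)
      have k: "s \<in> carrier R" "t \<in> carrier R" "u \<in> carrier R" using * S by auto
      have "u \<otimes> (b \<otimes> s \<ominus> a \<otimes> t) = \<zero>"
        using *(3,4,8) k by (simp add: mult_minus_eq_zero_iff)
      then show "(q, p) \<in> loc_rel R S"
        using *(1-7) by (auto simp: loc_rel_def)
    qed
    show "trans (loc_rel R S)"
    proof (rule transI)
      fix p q r assume 1: "(p, q) \<in> loc_rel R S" and 2: "(q, r) \<in> loc_rel R S"
      obtain a s b t u where "p = (a, s)" "q = (b, t)" "a \<in> carrier R" "b \<in> carrier R"
        "s \<in> S" "t \<in> S" "u \<in> S" and e1: "u \<otimes> (a \<otimes> t \<ominus> b \<otimes> s) = \<zero>"
        using 1 by (rule loc_relE)
      moreover obtain b' t' c w v where "q = (b', t')" "r = (c, w)" "c \<in> carrier R" "w \<in> S" "v \<in> S"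
        and e2: "v \<otimes> (b' \<otimes> w \<ominus> c \<otimes> t') = \<zero>"
        using 2 by (rule loc_relE)
      ultimately have *: "p = (a, s)" "q = (b, t)" "r = (c, w)"
        "a \<in> carrier R" "b \<in> carrier R" "c \<in> carrier R" "s \<in> S" "t \<in> S" "w \<in> S" "u \<in> S" "v \<in> S"
        and e: "u \<otimes> (a \<otimes> t \<ominus> b \<otimes> s) = \<zero>" "v \<otimes> (b \<otimes> w \<ominus> c \<otimes> t) = \<zero>"
        by simp_all
      have c: "s \<in> carrier R" "t \<in> carrier R" "w \<in> carrier R" "u \<in> carrier R" "v \<in> carrier R"
        using * S by auto
      have e': "u \<otimes> (a \<otimes> t) = u \<otimes> (b \<otimes> s)" "v \<otimes> (b \<otimes> w) = v \<otimes> (c \<otimes> t)"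
        using e *(4-6) c by (simp_all add: mult_minus_eq_zero_iff)
      have "(u \<otimes> v \<otimes> t) \<otimes> (a \<otimes> w) = (v \<otimes> w) \<otimes> (u \<otimes> (a \<otimes> t))"
        using *(4-6) c by (simp add: m_ac)
      also have "\<dots> = (u \<otimes> s) \<otimes> (v \<otimes> (b \<otimes> w))"
        using *(4-6) c unfolding e'(1) by (simp add: m_ac)
      also have "\<dots> = (u \<otimes> v \<otimes> t) \<otimes> (c \<otimes> s)"
        using *(4-6) c unfolding e'(2) by (simp add: m_ac)
      finally have "(u \<otimes> v \<otimes> t) \<otimes> (a \<otimes> w \<ominus> c \<otimes> s) = \<zero>"
        using *(4-6) c by (simp add: mult_minus_eq_zero_iff)
      moreover have "u \<otimes> v \<otimes> t \<in> S" using * by (intro S.m_closed)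
      ultimately show "(p, r) \<in> loc_rel R S"
        using *(1,3,4,6,7,9) by (auto simp: loc_rel_def)
    qed
  qed
qed

lemma (in cring) loc_frac_eq_iff:
  assumes "submonoid S R" "a \<in> carrier R" "b \<in> carrier R" "s \<in> S" "t \<in> S"
  shows "loc_frac R S a s = loc_frac R S b t \<longleftrightarrow> (\<exists>u\<in>S. u \<otimes> (a \<otimes> t \<ominus> b \<otimes> s) = \<zero>)"
  using eq_equiv_class_iff[OF loc_rel_equiv[OF assms(1)], of "(a, s)" "(b, t)"] assms
  unfolding loc_frac_def by (auto simp: loc_rel_def)

lemma (in cring) loc_frac_self:
  assumes "submonoid S R" "a \<in> carrier R" "s \<in> S"
  shows "(a, s) \<in> loc_frac R S a s"
  unfolding loc_frac_def
  using equiv_class_self[OF loc_rel_equiv[OF assms(1)], of "(a, s)"] assms by blast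

lemma carrier_localization:
  "carrier (localization R S) = {loc_frac R S a s | a s. a \<in> carrier R \<and> s \<in> S}"
  unfolding localization_def loc_frac_def quotient_def by auto

lemma loc_one: "\<one>\<^bsub>localization R S\<^esub> = loc_frac R S \<one>\<^bsub>R\<^esub> \<one>\<^bsub>R\<^esub>"
  and loc_zero: "\<zero>\<^bsub>localization R S\<^esub> = loc_frac R S \<zero>\<^bsub>R\<^esub> \<one>\<^bsub>R\<^esub>"
  by (simp_all add: localization_def)

lemma loc_frac_memD:
  assumes "(c, w) \<in> loc_frac R S a s"
  obtains u where "c \<in> carrier R" "w \<in> S" "u \<in> S"
    "u \<otimes>\<^bsub>R\<^esub> (a \<otimes>\<^bsub>R\<^esub> w \<ominus>\<^bsub>R\<^esub> c \<otimes>\<^bsub>R\<^esub> s) = \<zero>\<^bsub>R\<^esub>"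
  using assms unfolding loc_frac_def loc_rel_def by auto

lemma UN_pair_const:
  assumes "(a, s) \<in> A" "(b, t) \<in> B"
    and "\<And>c w d z. (c, w) \<in> A \<Longrightarrow> (d, z) \<in> B \<Longrightarrow> F c w d z = K"
  shows "(\<Union>(c, w)\<in>A. \<Union>(d, z)\<in>B. F c w d z) = K"
proof -
  have "(\<Union>(c, w)\<in>A. \<Union>(d, z)\<in>B. F c w d z) = (\<Union>p\<in>A. \<Union>q\<in>B. K)"
    using assms(3) by (intro SUP_cong refl) auto
  then show ?thesis using assms(1,2) by auto
qed

lemma (in cring) loc_mult:
  assumes "submonoid S R" "a \<in> carrier R" "b \<in> carrier R" "s \<in> S" "t \<in> S"
  shows "loc_frac R S a s \<otimes>\<^bsub>localization R S\<^esub> loc_frac R S b t = loc_frac R S (a \<otimes> b) (s \<otimes> t)"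
proof -
  interpret S: submonoid S R by fact
  have S: "x \<in> carrier R" if "x \<in> S" for x using that S.subset by blast
  have *: "loc_frac R S (c \<otimes> d) (w \<otimes> z) = loc_frac R S (a \<otimes> b) (s \<otimes> t)"
    if p: "(c, w) \<in> loc_frac R S a s" "(d, z) \<in> loc_frac R S b t" for c w d z
  proof -
    obtain u where h1: "c \<in> carrier R" "w \<in> S" "u \<in> S" "u \<otimes> (a \<otimes> w \<ominus> c \<otimes> s) = \<zero>"
      using p(1) by (rule loc_frac_memD)
    obtain v where h2: "d \<in> carrier R" "z \<in> S" "v \<in> S" "v \<otimes> (b \<otimes> z \<ominus> d \<otimes> t) = \<zero>"
      using p(2) by (rule loc_frac_memD)
    note h = h1 h2
    have k: "s \<in> carrier R" "t \<in> carrier R" "w \<in> carrier R" "z \<in> carrier R" "u \<in> carrier R"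
      "v \<in> carrier R" using S h assms by auto
    have e: "u \<otimes> (c \<otimes> s) = u \<otimes> (a \<otimes> w)" "v \<otimes> (d \<otimes> t) = v \<otimes> (b \<otimes> z)"
      using h k assms(2,3) by (simp_all add: mult_minus_eq_zero_iff)
    have "(u \<otimes> v) \<otimes> ((c \<otimes> d) \<otimes> (s \<otimes> t)) = (u \<otimes> (c \<otimes> s)) \<otimes> (v \<otimes> (d \<otimes> t))"
      using h(1,5) k assms(2,3) by (simp add: m_ac)
    also have "\<dots> = (u \<otimes> v) \<otimes> ((a \<otimes> b) \<otimes> (w \<otimes> z))"
      using k assms(2,3) unfolding e by (simp add: m_ac)
    finally show ?thesis
      using h k assms
      by (subst loc_frac_eq_iff) (auto simp: mult_minus_eq_zero_iff intro!: bexI[of _ "u \<otimes> v"])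
  qed
  show ?thesis
    unfolding localization_def
    using UN_pair_const[OF loc_frac_self[OF assms(1,2,4)] loc_frac_self[OF assms(1,3,5)] *]
    by simp
qed

lemma (in cring) loc_add:
  assumes "submonoid S R" "a \<in> carrier R" "b \<in> carrier R" "s \<in> S" "t \<in> S"
  shows "loc_frac R S a s \<oplus>\<^bsub>localization R S\<^esub> loc_frac R S b t =
    loc_frac R S (a \<otimes> t \<oplus> b \<otimes> s) (s \<otimes> t)"
proof -
  interpret S: submonoid S R by fact
  have S: "x \<in> carrier R" if "x \<in> S" for x using that S.subset by blast
  have *: "loc_frac R S (c \<otimes> z \<oplus> d \<otimes> w) (w \<otimes> z) = loc_frac R S (a \<otimes> t \<oplus> b \<otimes> s) (s \<otimes> t)"
    if p: "(c, w) \<in> loc_frac R S a s" "(d, z) \<in> loc_frac R S b t" for c w d z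
  proof -
    obtain u where h1: "c \<in> carrier R" "w \<in> S" "u \<in> S" "u \<otimes> (a \<otimes> w \<ominus> c \<otimes> s) = \<zero>"
      using p(1) by (rule loc_frac_memD)
    obtain v where h2: "d \<in> carrier R" "z \<in> S" "v \<in> S" "v \<otimes> (b \<otimes> z \<ominus> d \<otimes> t) = \<zero>"
      using p(2) by (rule loc_frac_memD)
    note h = h1 h2
    have k: "s \<in> carrier R" "t \<in> carrier R" "w \<in> carrier R" "z \<in> carrier R" "u \<in> carrier R"
      "v \<in> carrier R" using S h assms by auto
    have e: "u \<otimes> (c \<otimes> s) = u \<otimes> (a \<otimes> w)" "v \<otimes> (d \<otimes> t) = v \<otimes> (b \<otimes> z)"
      using h k assms(2,3) by (simp_all add: mult_minus_eq_zero_iff)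
    have "(u \<otimes> v) \<otimes> ((c \<otimes> z \<oplus> d \<otimes> w) \<otimes> (s \<otimes> t)) =
        (v \<otimes> t \<otimes> z) \<otimes> (u \<otimes> (c \<otimes> s)) \<oplus> (u \<otimes> s \<otimes> w) \<otimes> (v \<otimes> (d \<otimes> t))"
      using h(1,5) k assms(2,3) by (simp add: l_distr r_distr m_ac)
    also have "\<dots> = (u \<otimes> v) \<otimes> ((a \<otimes> t \<oplus> b \<otimes> s) \<otimes> (w \<otimes> z))"
      using k assms(2,3) unfolding e by (simp add: l_distr r_distr m_ac)
    finally show ?thesis
      using h k assms
      by (subst loc_frac_eq_iff) (auto simp: mult_minus_eq_zero_iff intro!: bexI[of _ "u \<otimes> v"])
  qed
  show ?thesis
    unfolding localization_def
    using UN_pair_const[OF loc_frac_self[OF assms(1,2,4)] loc_frac_self[OF assms(1,3,5)] *]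
    by simp
qed

lemma (in cring) loc_frac_eqI:
  assumes "submonoid S R" "a \<in> carrier R" "b \<in> carrier R" "s \<in> S" "t \<in> S"
    and "a \<otimes> t = b \<otimes> s"
  shows "loc_frac R S a s = loc_frac R S b t"
proof -
  interpret S: submonoid S R by fact
  have "b \<otimes> s \<in> carrier R" using assms S.subset by blast
  then have "\<one> \<otimes> (a \<otimes> t \<ominus> b \<otimes> s) = \<zero>" using assms(6) by (simp add: a_minus_def r_neg)
  then show ?thesis using assms by (subst loc_frac_eq_iff) auto
qed

lemma (in cring) localization_cring:
  assumes "submonoid S R"
  shows "cring (localization R S)"
proof -
  interpret S: submonoid S R by fact
  have S: "x \<in> carrier R" if "x \<in> S" for x using that S.subset by blast
  note L = carrier_localization loc_one loc_zero
  note E = loc_add[OF assms] loc_mult[OF assms] S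
  show ?thesis
  proof (intro cringI abelian_groupI comm_monoidI)
    fix x assume "x \<in> carrier (localization R S)"
    then obtain a s where x: "x = loc_frac R S a s" "a \<in> carrier R" "s \<in> S" by (auto simp: L)
    have s: "s \<in> carrier R" using x S by blast
    show "\<zero>\<^bsub>localization R S\<^esub> \<oplus>\<^bsub>localization R S\<^esub> x = x"
      "\<one>\<^bsub>localization R S\<^esub> \<otimes>\<^bsub>localization R S\<^esub> x = x"
      using x by (simp_all add: L E)
    have "loc_frac R S (\<ominus> a) s \<oplus>\<^bsub>localization R S\<^esub> x = \<zero>\<^bsub>localization R S\<^esub>"
      using x s unfolding x(1) L
      by (simp add: E, intro loc_frac_eqI[OF assms]) (simp_all add: l_distr r_distr l_minus r_minus l_neg r_neg m_ac a_ac)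
    moreover have "loc_frac R S (\<ominus> a) s \<in> carrier (localization R S)"
      using x a_inv_closed unfolding carrier_localization by blast
    ultimately show "\<exists>y\<in>carrier (localization R S). y \<oplus>\<^bsub>localization R S\<^esub> x = \<zero>\<^bsub>localization R S\<^esub>"
      by blast
  next
    fix x y assume "x \<in> carrier (localization R S)" "y \<in> carrier (localization R S)"
    then obtain a s b t where x: "x = loc_frac R S a s" "a \<in> carrier R" "s \<in> S"
      and y: "y = loc_frac R S b t" "b \<in> carrier R" "t \<in> S" by (auto simp: L)
    show "x \<oplus>\<^bsub>localization R S\<^esub> y \<in> carrier (localization R S)"
      "x \<otimes>\<^bsub>localization R S\<^esub> y \<in> carrier (localization R S)"
      using x y by (auto simp: L E intro!: exI S.m_closed)
    show "x \<oplus>\<^bsub>localization R S\<^esub> y = y \<oplus>\<^bsub>localization R S\<^esub> x"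
      "x \<otimes>\<^bsub>localization R S\<^esub> y = y \<otimes>\<^bsub>localization R S\<^esub> x"
      using x y by (simp_all add: E m_comm a_comm)
  next
    fix x y z assume "x \<in> carrier (localization R S)" "y \<in> carrier (localization R S)"
      "z \<in> carrier (localization R S)"
    then obtain a s b t c u where x: "x = loc_frac R S a s" "a \<in> carrier R" "s \<in> S"
      and y: "y = loc_frac R S b t" "b \<in> carrier R" "t \<in> S"
      and z: "z = loc_frac R S c u" "c \<in> carrier R" "u \<in> S" by (auto simp: L)
    have k: "s \<in> carrier R" "t \<in> carrier R" "u \<in> carrier R" using x y z S by auto
    show "x \<oplus>\<^bsub>localization R S\<^esub> y \<oplus>\<^bsub>localization R S\<^esub> z =
        x \<oplus>\<^bsub>localization R S\<^esub> (y \<oplus>\<^bsub>localization R S\<^esub> z)"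
      using x y z k
      by (simp add: E, intro loc_frac_eqI[OF assms]) (simp_all add: l_distr r_distr l_minus l_neg m_ac a_ac)
    show "x \<otimes>\<^bsub>localization R S\<^esub> y \<otimes>\<^bsub>localization R S\<^esub> z =
        x \<otimes>\<^bsub>localization R S\<^esub> (y \<otimes>\<^bsub>localization R S\<^esub> z)"
      using x y z k by (simp add: E m_assoc)
    show "(x \<oplus>\<^bsub>localization R S\<^esub> y) \<otimes>\<^bsub>localization R S\<^esub> z =
        x \<otimes>\<^bsub>localization R S\<^esub> z \<oplus>\<^bsub>localization R S\<^esub> y \<otimes>\<^bsub>localization R S\<^esub> z"
      using x y z k
      by (simp add: E, intro loc_frac_eqI[OF assms]) (simp_all add: l_distr r_distr l_minus l_neg m_ac a_ac)
  qed (auto simp: L intro!: exI)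
qed

lemma (in cring) loc_map_hom:
  assumes "submonoid S R"
  shows "loc_map R S \<in> ring_hom R (localization R S)"
proof -
  interpret S: submonoid S R by fact
  show ?thesis
    by (rule ring_hom_memI)
      (auto simp: loc_map_def carrier_localization loc_one loc_add[OF assms] loc_mult[OF assms],
       blast intro: S.one_closed)
qed

end

theory Submission
  imports Defs
begin

text \<open>
  A set \<open>S\<close> that is strongly multiplicative contains an \<open>r\<close> divisible by every element of \<open>S\<close>;
  in particular \<open>r\<close> is divisible by \<open>s r\<close> for each \<open>s \<in> S\<close>, and cancelling the
  non-zerodivisor \<open>r\<close> makes \<open>s\<close> a unit.  In the same way \<open>s \<in> N(S)\<close> makes \<open>s\<close> a multiple of
  \<open>s\<^sup>2\<close>.  If localization commutes with intersections, then \<open>1/1 = s\<^sub>i/s\<^sub>i\<close> lies in the localization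
  of the intersection of the ideals \<open>s\<^sub>i R\<close>, so this intersection meets \<open>S\<close>.
\<close>

context cring
begin

lemma Reg_carrier: "r \<in> Reg R \<Longrightarrow> r \<in> carrier R"
  by (simp add: Reg_def)

lemma Reg_cancel:
  assumes "r \<in> Reg R" "x \<in> carrier R" "y \<in> carrier R" "r \<otimes> x = r \<otimes> y"
  shows "x = y"
proof -
  have "r \<otimes> (x \<ominus> y) = \<zero>"
    using assms Reg_carrier by (simp add: mult_minus_eq_zero_iff)
  then have "x \<ominus> y = \<zero>"
    using assms unfolding Reg_def by simp
  \<comment> \<open>Taking the factor to be \<open>\<one>\<close> turns
    \<open>x \<ominus> y = \<zero>\<close> into \<open>x = y\<close>.\<close>
  then show ?thesis
    using assms mult_minus_eq_zero_iff[of \<one> x y] by simp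
qed

text \<open>Commutativity moves \<open>r\<close> to the front, and cancelling it leaves
  \<open>x\<close> as an inverse of \<open>s\<close>. The lemma is applied with \<open>r\<close> a
  common multiple of all elements of \<open>S\<close>, and with \<open>r = s\<close> for the
  condition on \<open>N_set\<close>.\<close>

lemma Reg_UnitsI:
  assumes "r \<in> Reg R" "s \<in> carrier R" "x \<in> carrier R" "r = x \<otimes> (s \<otimes> r)"
  shows "s \<in> Units R"
proof -
  have r: "r \<in> carrier R" using assms(1) by (rule Reg_carrier)
  have "r \<otimes> \<one> = r \<otimes> (x \<otimes> s)"
    using assms(2-4) r by (metis m_assoc m_closed m_comm r_one)
  then have "x \<otimes> s = \<one>"
    using assms(1-3) by (metis Reg_cancel m_closed one_closed)
  then show ?thesis
    using assms(2,3) m_comm[of s x] unfolding Units_def by auto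
qed

text \<open>The factor \<open>u\<close> in the relation lies in \<open>S\<close>, hence is regular
  and cancels, which leaves plain cross-multiplication.\<close>

lemma loc_frac_eq_iff_Reg:
  assumes "submonoid S R" "S \<subseteq> Reg R" "a \<in> carrier R" "b \<in> carrier R" "s \<in> S" "t \<in> S"
  shows "loc_frac R S a s = loc_frac R S b t \<longleftrightarrow> a \<otimes> t = b \<otimes> s"
proof -
  interpret S: submonoid S R by fact
  have c: "s \<in> carrier R" "t \<in> carrier R" using assms S.subset by auto
  show ?thesis
  proof
    assume "loc_frac R S a s = loc_frac R S b t"
    then obtain u where u: "u \<in> S" "u \<otimes> (a \<otimes> t \<ominus> b \<otimes> s) = \<zero>"
      using assms by (auto simp: loc_frac_eq_iff)
    then show "a \<otimes> t = b \<otimes> s"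
      using assms c S.subset Reg_cancel[of u "a \<otimes> t" "b \<otimes> s"]
      by (auto simp: mult_minus_eq_zero_iff subset_iff)
  qed (rule loc_frac_eqI[OF assms(1,3-6)])
qed

lemma strongly_multiplicative_Reg_iff_Units:
  assumes "S \<subseteq> Reg R" "multiplicative_set R S"
  shows "strongly_multiplicative R S \<longleftrightarrow> S \<subseteq> Units R"
proof
  interpret S: submonoid S R using assms(2) by (simp add: multiplicative_set_def)
  {
    assume "strongly_multiplicative R S"
    \<comment> \<open>The family consists of all elements of \<open>S\<close>, indexed by
      themselves.\<close>
    then have "(carrier R \<inter> (\<Inter>i\<in>S. PIdl i)) \<inter> S \<noteq> {}"
      by (rule strongly_multiplicative_family) simp
    then obtain r where r: "r \<in> S" "\<And>i. i \<in> S \<Longrightarrow> r \<in> PIdl i" by auto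
    show "S \<subseteq> Units R"
    proof
      fix s assume s: "s \<in> S"
      \<comment> \<open>The product \<open>s \<otimes> r\<close> is again in \<open>S\<close>, so it
        is one of the divisors of \<open>r\<close>.\<close>
      then have "r \<in> PIdl (s \<otimes> r)" using r by blast
      then obtain x where "x \<in> carrier R" "r = x \<otimes> (s \<otimes> r)"
        by (auto simp: cgenideal_def)
      then show "s \<in> Units R" using r(1) s assms(1) S.subset by (blast intro: Reg_UnitsI)
    qed
  next
    assume U: "S \<subseteq> Units R"
    \<comment> \<open>For units, \<open>\<one>\<close> is a common multiple of any family, and it
      lies in \<open>S\<close>.\<close>
    have "\<one> \<in> PIdl s" if "s \<in> S" for s
    proof -
      have "s \<in> Units R" using that U by blast
      then show ?thesis
        unfolding cgenideal_def by (auto intro!: exI[of _ "inv s"])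
    qed
    then show "strongly_multiplicative R S"
      using assms(2) unfolding strongly_multiplicative_def by (blast intro: S.one_closed)
  }
qed

lemma loc_commutes_Inter_imp_strongly_multiplicative:
  assumes "multiplicative_set R S" "loc_commutes_Inter R S"
  shows "strongly_multiplicative R S"
  unfolding strongly_multiplicative_def
proof (intro conjI allI impI)
  have sub: "submonoid S R" using assms(1) by (simp add: multiplicative_set_def)
  interpret S: submonoid S R by (fact sub)
  fix \<Delta> :: "'a set" and s assume s: "\<forall>i\<in>\<Delta>. s i \<in> S"
  have ideals: "\<forall>i\<in>\<Delta>. ideal (PIdl (s i)) R"
    using s S.subset by (blast intro: cgenideal_ideal)
  let ?J = "carrier R \<inter> (\<Inter>i\<in>\<Delta>. PIdl (s i))"
  have "loc_frac R S \<one> \<one> \<in> loc_ideal R S (PIdl (s i))" if "i \<in> \<Delta>" for i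
  proof -
    have i: "s i \<in> S" "s i \<in> carrier R" using that s S.subset by auto
    then have "loc_frac R S \<one> \<one> = loc_frac R S (s i) (s i)"
      by (intro loc_frac_eqI[OF sub]) auto
    then show ?thesis
      using i cgenideal_self unfolding loc_ideal_def by blast
  qed
  \<comment> \<open>This settles the empty family, where the intersection of localized ideals is the
    whole localization.\<close>
  moreover have "loc_frac R S \<one> \<one> \<in> carrier (localization R S)"
    using one_closed S.one_closed unfolding carrier_localization by blast
  ultimately have "loc_frac R S \<one> \<one> \<in> loc_ideal R S ?J"
    unfolding loc_commutes_Inter_family[OF assms(2) ideals] by blast
  then obtain b t where bt: "b \<in> ?J" "t \<in> S" "loc_frac R S \<one> \<one> = loc_frac R S b t"
    unfolding loc_ideal_def by blast
  then have c: "b \<in> carrier R" "t \<in> carrier R" using S.subset by auto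
  \<comment> \<open>The equality of fractions does not give \<open>b = t\<close>, only equality
    after multiplying by some \<open>u\<close>. So the element of \<open>S\<close> in the
    intersection is \<open>u \<otimes> t\<close>, which equals \<open>u \<otimes> b\<close>.\<close>
  obtain u where u: "u \<in> S" "u \<otimes> (\<one> \<otimes> t \<ominus> b \<otimes> \<one>) = \<zero>"
    using bt c by (auto simp: loc_frac_eq_iff[OF sub])
  have uc: "u \<in> carrier R" using u(1) S.subset by blast
  have eq: "u \<otimes> t = u \<otimes> b" using u c uc by (simp add: mult_minus_eq_zero_iff)
  have "u \<otimes> b \<in> PIdl (s i)" if "i \<in> \<Delta>" for i
    using that ideals bt(1) uc by (blast intro: ideal.I_l_closed)
  then have "u \<otimes> t \<in> ?J"
    using c uc unfolding eq by blast
  moreover have "u \<otimes> t \<in> S" using u(1) bt(2) by (rule S.m_closed)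
  ultimately show "?J \<inter> S \<noteq> {}" by blast
qed (fact assms(1))

lemma Units_subset_Reg: "Units R \<subseteq> Reg R"
proof
  fix s assume s: "s \<in> Units R"
  then show "s \<in> Reg R"
    unfolding Reg_def by (auto simp: Units_closed) (metis Units_closed Units_l_cancel r_null zero_closed)
qed

lemma Units_imp_loc_commutes_Inter:
  assumes "submonoid S R" "S \<subseteq> Units R"
  shows "loc_commutes_Inter R S"
  unfolding loc_commutes_Inter_def
proof (intro allI impI equalityI subsetI)
  interpret S: submonoid S R by fact
  fix \<Lambda> :: "'a set set" and I x
  assume I: "\<forall>i\<in>\<Lambda>. ideal (I i) R"
  let ?J = "carrier R \<inter> (\<Inter>i\<in>\<Lambda>. I i)"
  {
    assume "x \<in> loc_ideal R S ?J"
    then show "x \<in> carrier (localization R S) \<inter> (\<Inter>i\<in>\<Lambda>. loc_ideal R S (I i))"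
      unfolding loc_ideal_def carrier_localization by blast
  next
    assume x: "x \<in> carrier (localization R S) \<inter> (\<Inter>i\<in>\<Lambda>. loc_ideal R S (I i))"
    \<comment> \<open>One representative is fixed before any index is chosen. The same numerator
      \<open>a\<close> is then shown to lie in every \<open>I i\<close>, by multiplying
      \<open>a \<otimes> t = b \<otimes> s\<close> with the inverse of \<open>t\<close>.\<close>
    then obtain a s where as: "x = loc_frac R S a s" "a \<in> carrier R" "s \<in> S"
      unfolding carrier_localization by blast
    have "a \<in> I i" if i: "i \<in> \<Lambda>" for i
    proof -
      interpret I: ideal "I i" R using I i by blast
      obtain b t where bt: "b \<in> I i" "t \<in> S" "x = loc_frac R S b t"
        using x i unfolding loc_ideal_def by blast
      have t: "t \<in> Units R" and c: "b \<in> carrier R" "s \<in> carrier R"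
        using bt as assms(2) S.subset I.a_subset by auto
      have "a \<otimes> t = b \<otimes> s"
        using loc_frac_eq_iff_Reg[OF assms(1), of a b s t] assms(2) Units_subset_Reg as bt c by auto
      then have "a \<otimes> t \<in> I i" using bt(1) c I.I_r_closed by simp
      then have "a \<otimes> t \<otimes> inv t \<in> I i" using t I.I_r_closed by simp
      then show ?thesis using as(2) t by (simp add: m_assoc Units_closed)
    qed
    then show "x \<in> loc_ideal R S ?J"
      using as unfolding loc_ideal_def by blast
  }
qed

lemma cgenideal_eq_carrier:
  assumes "s \<in> Units R"
  shows "PIdl s = carrier R"
proof -
  interpret ideal "PIdl s" R using assms by (intro cgenideal_ideal) auto
  have "s \<in> PIdl s" using assms by (intro cgenideal_self) auto
  then have "inv s \<otimes> s \<in> PIdl s" using assms by (intro I_l_closed) auto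
  then show ?thesis using assms by (intro one_imp_carrier) auto
qed

lemma cgenideal_mult_Unit:
  assumes "x \<in> carrier R" "s \<in> Units R"
  shows "PIdl (x \<otimes> s) = PIdl x"
proof
  have sc: "s \<in> carrier R" using assms(2) by auto
  have "x \<otimes> s \<in> PIdl x"
    using assms sc by (auto simp: cgenideal_def m_comm)
  then show "PIdl (x \<otimes> s) \<subseteq> PIdl x"
    using assms(1) by (intro cgenideal_minimal cgenideal_ideal)
  have "x = inv s \<otimes> (x \<otimes> s)"
    using assms sc by (simp add: m_lcomm[of "inv s" x s])
  then have "x \<in> PIdl (x \<otimes> s)"
    using assms(2) unfolding cgenideal_def by blast
  then show "PIdl x \<subseteq> PIdl (x \<otimes> s)"
    using assms(1) sc by (intro cgenideal_minimal cgenideal_ideal) auto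
qed

text \<open>If \<open>s\<close> is a unit, then \<open>PIdl s\<close> is the whole ring and
  \<open>x \<otimes> s\<close> is an associate of \<open>x\<close>, so both sides of the defining
  equation are \<open>PIdl x\<close>. The converse tests that equation at
  \<open>x = s\<close>.\<close>

lemma Units_iff_N_set_eq_Reg:
  assumes "S \<subseteq> Reg R"
  shows "S \<subseteq> Units R \<longleftrightarrow> N_set R S = Reg R"
proof
  assume U: "S \<subseteq> Units R"
  have "PIdl x \<inter> PIdl s = PIdl (x \<otimes> s)" if "x \<in> Reg R" "s \<in> S" for x s
  proof -
    have x: "x \<in> carrier R" using that(1) by (rule Reg_carrier)
    then have "PIdl x \<subseteq> carrier R"
      by (auto simp: cgenideal_def)
    then show ?thesis
      using x that(2) U by (auto simp: cgenideal_eq_carrier cgenideal_mult_Unit subset_iff)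
  qed
  then show "N_set R S = Reg R" unfolding N_set_def by blast
next
  assume N: "N_set R S = Reg R"
  show "S \<subseteq> Units R"
  proof
    fix s assume s: "s \<in> S"
    then have sR: "s \<in> Reg R" using assms by blast
    then have "s \<in> N_set R S" using N by simp
    \<comment> \<open>With \<open>x = s\<close> the intersection is that of \<open>PIdl s\<close>
      with itself.\<close>
    then have "PIdl s = PIdl (s \<otimes> s)" using s unfolding N_set_def by blast
    then have "s \<in> PIdl (s \<otimes> s)" using sR Reg_carrier cgenideal_self by blast
    then obtain x where "x \<in> carrier R" "s = x \<otimes> (s \<otimes> s)" by (auto simp: cgenideal_def)
    then show "s \<in> Units R" using sR Reg_carrier by (blast intro: Reg_UnitsI)
  qed
qed

lemma Units_imp_loc_map_iso:
  assumes "submonoid S R" "S \<subseteq> Units R"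
  shows "loc_map R S \<in> ring_iso R (localization R S)"
proof -
  interpret S: submonoid S R by fact
  have SR: "S \<subseteq> Reg R" using assms(2) Units_subset_Reg by blast
  have "inj_on (loc_map R S) (carrier R)"
    by (rule inj_onI) (simp add: loc_map_def loc_frac_eq_iff_Reg[OF assms(1) SR])
  moreover have "loc_map R S ` carrier R = carrier (localization R S)"
  proof
    show "loc_map R S ` carrier R \<subseteq> carrier (localization R S)"
      using ring_hom_closed[OF loc_map_hom[OF assms(1)]] by blast
    show "carrier (localization R S) \<subseteq> loc_map R S ` carrier R"
    proof
      fix x assume "x \<in> carrier (localization R S)"
      then obtain a s where as: "x = loc_frac R S a s" "a \<in> carrier R" "s \<in> S"
        unfolding carrier_localization by blast
      have s: "s \<in> Units R" using as(3) assms(2) by blast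
      \<comment> \<open>A unit denominator can be absorbed into the numerator, which gives
        surjectivity.\<close>
      have "x = loc_map R S (a \<otimes> inv s)"
        using as s unfolding loc_map_def
        by (simp add: loc_frac_eq_iff_Reg[OF assms(1) SR] m_assoc Units_closed)
      then show "x \<in> loc_map R S ` carrier R" using as(2) s by blast
    qed
  qed
  ultimately show ?thesis
    using loc_map_hom[OF assms(1)] unfolding ring_iso_def bij_betw_def by blast
qed

end

theorem corollary7p3:
  fixes R :: "('a, 'm) ring_scheme" (structure) and S :: "'a set"
  assumes "cring R" and "\<one> \<noteq> \<zero>"
    and "S \<subseteq> Reg R" and "S \<noteq> {}" and "multiplicative_set R S"
  shows "(loc_commutes_Inter R S \<longleftrightarrow> strongly_multiplicative R S) \<and>
         (strongly_multiplicative R S \<longleftrightarrow> (\<forall>s\<in>S. s \<in> Units R)) \<and>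
         ((\<forall>s\<in>S. s \<in> Units R) \<longleftrightarrow> N_set R S = Reg R) \<and>
         (\<forall>T. strongly_multiplicative R T \<and> loc_map R T \<notin> ring_iso R (localization R T) \<longrightarrow>
            (\<exists>t\<in>T. \<exists>x\<in>carrier R. x \<noteq> \<zero> \<and> t \<otimes> x = \<zero>))"
proof -
  interpret cring R by fact
  have sub: "submonoid S R" using assms(5) by (simp add: multiplicative_set_def)
  have "strongly_multiplicative R S \<longleftrightarrow> S \<subseteq> Units R"
    using assms(3,5) by (rule strongly_multiplicative_Reg_iff_Units)
  moreover have "loc_commutes_Inter R S \<longleftrightarrow> strongly_multiplicative R S"
    \<comment> \<open>Closes the cycle: commuting with intersections gives strong multiplicativity,
      which gives units, which gives commuting.\<close>
    using calculation assms(5) sub loc_commutes_Inter_imp_strongly_multiplicative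
      Units_imp_loc_commutes_Inter by blast
  moreover have "S \<subseteq> Units R \<longleftrightarrow> N_set R S = Reg R"
    using assms(3) by (rule Units_iff_N_set_eq_Reg)
  moreover have "\<exists>t\<in>T. \<exists>x\<in>carrier R. x \<noteq> \<zero> \<and> t \<otimes> x = \<zero>"
    if T: "strongly_multiplicative R T" "loc_map R T \<notin> ring_iso R (localization R T)" for T
  proof (rule ccontr)
    assume nz: "\<not> ?thesis"
    have mult: "multiplicative_set R T" using T(1) by (simp add: strongly_multiplicative_def)
    then have subT: "submonoid T R" by (simp add: multiplicative_set_def)
    \<comment> \<open>Without zero divisors \<open>T\<close> consists of regular elements, so the
      equivalence for \<open>S\<close> applies to \<open>T\<close> and the localization map is an
      isomorphism.\<close>
    then have "T \<subseteq> Reg R" using nz submonoid.subset unfolding Reg_def by blast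
    then have "T \<subseteq> Units R"
      using strongly_multiplicative_Reg_iff_Units mult T(1) by blast
    then show False using Units_imp_loc_map_iso subT T(2) by blast
  qed
  ultimately show ?thesis by (auto simp: subset_iff)
qed

end
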